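(* Let $k\ge 1$, let $\beta_1,\ldots,\beta_k$ be real numbers that are all negative, and let $H_1,\ldots,H_k$ be finite simple graphs, where $H_1$ is a single edge. Let $(\alpha_n)$ be a sequence of real numbers with $\alpha_n\to\infty$ as $n\to\infty$, and let $\mathbb{P}^{(n)}$ be the exponential random graph measure on simple graphs on $\{1,\ldots,n\}$ with parameters $\beta_p^{(n)}=\beta_p\alpha_n$, $p=1,\ldots,k$ (defined in the context). Assume further that $\lim_{n\to\infty}n^2e^{2\alpha_n\beta_1}=0$ and $\lim_{n\to\infty}\frac{\alpha_n}{n}=0$. Then $$\lim_{n\to\infty}\frac{\mathbb{P}^{(n)}(X_{1i}=1)}{e^{2\alpha_n\beta_1}}=1,\qquad i\ne 1.$$
   Context: Undirected simple graphs $G_n$ (no loops, no multiple edges) on the vertex set $\{1,\ldots,n\}$ are represented by arrays $(X_{ij})_{1\le i<j\le n}$ with $X_{ij}\in\{0,1\}$, where $X_{ij}=1$ if and only if there is an edge between $i$ and $j$. For a finite simple graph $H$ with $v(H)$ vertices, the homomorphism density is $t(H,G_n)=|\mathrm{hom}(H,G_n)|/n^{v(H)}$, where $\mathrm{hom}(H,G_n)$ is the set of edge-preserving maps $V(H)\to V(G_n)$. The measure $\mathbb{P}^{(n)}$ on the set of all such graphs is $$\mathbb{P}^{(n)}(G_n)=Z_n^{-1}\exp\left[n^2\sum_{p=1}^k\beta_p^{(n)}\,t(H_p,G_n)\right],\qquad \beta_p^{(n)}=\beta_p\alpha_n,$$ where $Z_n=\sum_{G_n}\exp\left[n^2\sum_{p=1}^k\beta_p^{(n)}\,t(H_p,G_n)\right]$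 is the normalization, the sum being over all simple graphs on $\{1,\ldots,n\}$.
   Formalization: It is additionally assumed that none of H_2,…,H_k has exactly one edge; otherwise the claim fails, e.g. for H_2 also a single edge, β_1=β_2=−1, α_n=2 ln(n+1), where the ratio tends to 0. *)

theory Defs
  imports "HOL-Probability.Probability" "Graph_Theory.Pair_Digraph"
begin

text \<open>
  Finite simple graphs are the library's pair graphs (locale \<^locale>\<open>pair_graph\<close>): a finite vertex
  set with a symmetric, irreflexive arc relation.  An undirected edge between u and v is thus
  the pair of arcs (u, v) and (v, u).
\<close>

definition simple_graphs :: "nat \<Rightarrow> nat pair_pre_digraph set" where
  "simple_graphs n = {G. pair_graph G \<and> pverts G = {1..n}}"

definition edge_indicator :: "'a \<Rightarrow> 'a \<Rightarrow> 'a pair_pre_digraph \<Rightarrow> nat" where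
  "edge_indicator i j G = (if (i, j) \<in> parcs G then 1 else 0)"

definition undirected_edges :: "'a pair_pre_digraph \<Rightarrow> 'a set set" where
  "undirected_edges G = {{u, v} | u v. (u, v) \<in> parcs G}"

definition is_single_edge :: "'a pair_pre_digraph \<Rightarrow> bool" where
  "is_single_edge G \<longleftrightarrow> (\<exists>u v. u \<noteq> v \<and> pverts G = {u, v} \<and> parcs G = {(u, v), (v, u)})"

text \<open>Extensional functions (\<open>\<rightarrow>\<^sub>E\<close>) make the maps on the vertex set countable as a finite set.\<close>

definition graph_homs :: "'a pair_pre_digraph \<Rightarrow> 'b pair_pre_digraph \<Rightarrow> ('a \<Rightarrow> 'b) set" where
  "graph_homs H G =
     {f \<in> pverts H \<rightarrow>\<^sub>E pverts G. \<forall>(u, v) \<in> parcs H. (f u, f v) \<in> parcs G}"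

definition hom_density :: "'a pair_pre_digraph \<Rightarrow> 'b pair_pre_digraph \<Rightarrow> real" where
  "hom_density H G =
     real (card (graph_homs H G)) / real (card (pverts G)) ^ card (pverts H)"

definition ergm_weight ::
  "nat \<Rightarrow> nat \<Rightarrow> (nat \<Rightarrow> real) \<Rightarrow> (nat \<Rightarrow> 'a pair_pre_digraph) \<Rightarrow> nat pair_pre_digraph \<Rightarrow> real" where
  "ergm_weight n k b H G = exp ((real n)\<^sup>2 * (\<Sum>p = 1..k. b p * hom_density (H p) G))"

definition ergm_partition ::
  "nat \<Rightarrow> nat \<Rightarrow> (nat \<Rightarrow> real) \<Rightarrow> (nat \<Rightarrow> 'a pair_pre_digraph) \<Rightarrow> real" where
  "ergm_partition n k b H = (\<Sum>G \<in> simple_graphs n. ergm_weight n k b H G)"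

definition ergm ::
  "nat \<Rightarrow> nat \<Rightarrow> (nat \<Rightarrow> real) \<Rightarrow> (nat \<Rightarrow> 'a pair_pre_digraph) \<Rightarrow> nat pair_pre_digraph measure" where
  "ergm n k b H =
     point_measure (simple_graphs n) (\<lambda>G. ennreal (ergm_weight n k b H G / ergm_partition n k b H))"

lemma finite_simple_graphs: "finite (simple_graphs n)"
proof (rule finite_subset)
  let ?F = "\<lambda>E. \<lparr>pverts = {1..n}, parcs = E\<rparr> :: nat pair_pre_digraph"
  show "simple_graphs n \<subseteq> ?F ` Pow ({1..n} \<times> {1..n})"
  proof
    fix G assume "G \<in> simple_graphs n"
    then have G: "pair_graph G" "pverts G = {1..n}" by (auto simp: simple_graphs_def)
    interpret pair_graph G by (rule G(1))
    have "parcs G \<subseteq> {1..n} \<times> {1..n}"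
      using G(2) arc_fst_in_verts arc_snd_in_verts by (auto simp: subset_iff)
    moreover have "G = ?F (parcs G)" using G(2) by simp
    ultimately show "G \<in> ?F ` Pow ({1..n} \<times> {1..n})" by blast
  qed
qed simp

lemma simple_graphs_nonempty: "simple_graphs n \<noteq> {}"
proof -
  have "pair_graph (\<lparr>pverts = {1..n}, parcs = {}\<rparr> :: nat pair_pre_digraph)"
    by unfold_locales (auto simp: symmetric_def arcs_ends_def sym_def)
  then show ?thesis by (force simp: simple_graphs_def)
qed

lemma ergm_partition_pos: "0 < ergm_partition n k b H"
  unfolding ergm_partition_def ergm_weight_def
  using finite_simple_graphs simple_graphs_nonempty by (intro sum_pos) auto

lemma prob_space_ergm: "prob_space (ergm n k b H)"
proof
  have "(\<Sum>G \<in> simple_graphs n. ergm_weight n k b H G / ergm_partition n k b H) = 1"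
    using ergm_partition_pos[of n k b H]
    by (simp add: ergm_partition_def flip: sum_divide_distrib)
  moreover have "0 \<le> ergm_weight n k b H G / ergm_partition n k b H" for G
    using ergm_partition_pos[of n k b H] by (simp add: ergm_weight_def)
  ultimately show "emeasure (ergm n k b H) (space (ergm n k b H)) = 1"
    by (simp add: ergm_def space_point_measure emeasure_point_measure_finite finite_simple_graphs
        sum_ennreal)
qed

end

theory Submission
  imports Defs
begin

text \<open>
  With q = exp (2 \<beta>_1 \<alpha>_n), every edge costs at least a factor q relative to the empty graph, because
  homomorphism densities are monotone and the coefficients are negative. Expanding over edge sets,
  the partition function and the total weight of the graphs containing a given edge are therefore
  at most (1 + q)^(n^2) and q (1 + q)^(n^2), up to the weight of the empty graph, and
  (1 + q)^(n^2) tends to 1. Conversely the graph whose only edge is the given one has weight at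
  least q exp (-C \<alpha>_n / n): a graph with two edges has three non-isolated vertices, each of which a
  homomorphism must send to one of two vertices, so its density is at most 8 / n^3.
\<close>

section \<open>Encoding a simple graph by one arc per undirected edge\<close>

definition upper_arcs :: "'a::linorder pair_pre_digraph \<Rightarrow> 'a rel" where
  "upper_arcs G = {(u, v) \<in> parcs G. u < v}"

definition arc_graph :: "nat \<Rightarrow> nat rel \<Rightarrow> nat pair_pre_digraph" where
  "arc_graph n A = \<lparr>pverts = {1..n}, parcs = A\<rparr>"

lemma arc_graph_simps [simp]: "pverts (arc_graph n A) = {1..n}" "parcs (arc_graph n A) = A"
  by (simp_all add: arc_graph_def)

lemma simple_graphsD:
  assumes "G \<in> simple_graphs n"
  shows "pverts G = {1..n}" "finite (parcs G)" "parcs G \<subseteq> {1..n} \<times> {1..n}"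
    "(u, v) \<in> parcs G \<Longrightarrow> (v, u) \<in> parcs G" "(u, v) \<in> parcs G \<Longrightarrow> u \<noteq> v"
proof -
  from assms have G: "pair_graph G" "pverts G = {1..n}" by (auto simp: simple_graphs_def)
  interpret pair_graph G by (rule G(1))
  show "pverts G = {1..n}" by (rule G(2))
  show "finite (parcs G)" by (rule pair_finite_arcs)
  show "parcs G \<subseteq> {1..n} \<times> {1..n}"
    using G(2) in_arcsD1 in_arcsD2 by fast
  show "(u, v) \<in> parcs G \<Longrightarrow> (v, u) \<in> parcs G" by (rule arcs_symmetric)
  show "(u, v) \<in> parcs G \<Longrightarrow> u \<noteq> v" using pair_no_loops by fastforce
qed

lemma empty_graph_simple: "arc_graph n {} \<in> simple_graphs n"
  unfolding simple_graphs_def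
  by (auto, unfold_locales) (auto simp: symmetric_def sym_def)

lemma edge_graph_simple:
  assumes "i \<in> {1..n}" "j \<in> {1..n}" "i \<noteq> j"
  shows "arc_graph n {(i, j), (j, i)} \<in> simple_graphs n"
  unfolding simple_graphs_def using assms
  by (auto, unfold_locales) (auto simp: symmetric_def sym_def)

lemma parcs_conv_upper_arcs:
  assumes "G \<in> simple_graphs n"
  shows "parcs G = upper_arcs G \<union> (upper_arcs G)\<inverse>"
  using simple_graphsD(4,5)[OF assms] by (auto simp: upper_arcs_def) (metis linorder_neqE_nat)+

lemma card_parcs:
  assumes "G \<in> simple_graphs n"
  shows "card (parcs G) = 2 * card (upper_arcs G)"
proof -
  have fin: "finite (upper_arcs G)"
    using simple_graphsD(2)[OF assms] by (rule finite_subset[rotated]) (auto simp: upper_arcs_def)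
  have "upper_arcs G \<inter> (upper_arcs G)\<inverse> = {}" by (auto simp: upper_arcs_def)
  moreover have "card ((upper_arcs G)\<inverse>) = card (upper_arcs G)" by (rule card_inverse)
  ultimately show ?thesis
    by (subst parcs_conv_upper_arcs[OF assms], subst card_Un_disjoint) (use fin in auto)
qed

text \<open>A graph is the symmetric closure of its upper arcs on a fixed vertex set. Sums over
  graphs can thus be compared with sums over subsets of
  \<open>{1..n} \<times> {1..n}\<close>.\<close>

lemma inj_on_upper_arcs: "inj_on upper_arcs (simple_graphs n)"
proof (rule inj_onI)
  fix G G' :: "nat pair_pre_digraph"
  assume "G \<in> simple_graphs n" "G' \<in> simple_graphs n" "upper_arcs G = upper_arcs G'"
  then show "G = G'"
    using parcs_conv_upper_arcs simple_graphsD(1) by (metis pair_pre_digraph.equality unit.exhaust)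
qed

section \<open>Generating-function bounds for sums over edge sets\<close>

lemma sum_power_card_le_exp:
  fixes q :: real
  assumes "0 \<le> q" "finite A" "inj_on g T" "g ` T \<subseteq> Pow A"
  shows "(\<Sum>G\<in>T. q ^ card (g G)) \<le> exp (card A * q)"
proof -
  have "(\<Sum>G\<in>T. q ^ card (g G)) = (\<Sum>S\<in>g ` T. q ^ card S)"
    using assms(3) by (simp add: sum.reindex)
  also have "\<dots> \<le> (\<Sum>S\<in>Pow A. q ^ card S)"
    using assms by (intro sum_mono2) auto
  \<comment> \<open>Multiplying out, each x in A contributes either q or 1, and the choices of q are
    the subsets of A.\<close>
  also have "\<dots> = (\<Prod>x\<in>A. q + 1)"
    using prod_add[OF assms(2), of "\<lambda>_. q" "\<lambda>_. 1"] by simp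
  also have "\<dots> = (1 + q) ^ card A" by (simp add: add.commute)
  also have "\<dots> \<le> exp q ^ card A"
    using assms(1) by (intro power_mono) auto
  finally show ?thesis by (simp add: exp_of_nat_mult)
qed

text \<open>Taking all n^2 pairs as possible arcs overcounts the candidate edges, but the cruder
  exponent is enough since n^2 q will tend to 0.\<close>

lemma sum_edges_le_exp:
  fixes q :: real
  assumes "0 \<le> q"
  shows "(\<Sum>G\<in>simple_graphs n. q ^ card (upper_arcs G)) \<le> exp ((real n)\<^sup>2 * q)"
  using sum_power_card_le_exp[OF assms, of "{1..n} \<times> {1..n}" upper_arcs "simple_graphs n"]
    simple_graphsD(3) inj_on_upper_arcs
  by (fastforce simp: upper_arcs_def power2_eq_square)

text \<open>The prescribed edge contributes the factor q. Deleting it leaves an arbitrary edge set,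
  to which the general bound applies.\<close>

lemma sum_edges_containing_le_exp:
  fixes q :: real
  assumes "0 \<le> q" "i < j"
  shows "(\<Sum>G | G \<in> simple_graphs n \<and> (i, j) \<in> parcs G. q ^ card (upper_arcs G))
    \<le> q * exp ((real n)\<^sup>2 * q)"
proof -
  let ?T = "{G \<in> simple_graphs n. (i, j) \<in> parcs G}"
  let ?g = "\<lambda>G. upper_arcs G - {(i, j)}"
  \<comment> \<open>Since i < j, the prescribed edge is represented by (i, j) itself. Reinserting it
    recovers \<open>upper_arcs G\<close>, so the deletion stays injective.\<close>
  have e: "insert (i, j) (?g G) = upper_arcs G" if "G \<in> ?T" for G
    using that assms(2) by (auto simp: upper_arcs_def)
  have fin: "finite (upper_arcs G)" if "G \<in> ?T" for G
    using that simple_graphsD(2) by (auto simp: upper_arcs_def intro: finite_subset[rotated])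
  have "inj_on ?g ?T"
    by (rule inj_onI) (metis (no_types, lifting) e inj_onD inj_on_upper_arcs mem_Collect_eq)
  moreover have "?g ` ?T \<subseteq> Pow ({1..n} \<times> {1..n})"
    using simple_graphsD(3) by (fastforce simp: upper_arcs_def)
  ultimately have "(\<Sum>G\<in>?T. q ^ card (?g G)) \<le> exp (real (card ({1..n} \<times> {1..n})) * q)"
    using assms(1) by (intro sum_power_card_le_exp) auto
  then have "q * (\<Sum>G\<in>?T. q ^ card (?g G)) \<le> q * exp ((real n)\<^sup>2 * q)"
    using assms(1) by (intro mult_left_mono) (simp_all add: power2_eq_square)
  moreover have "q ^ card (upper_arcs G) = q * q ^ card (?g G)" if "G \<in> ?T" for G
    using card_insert_disjoint[of "?g G" "(i, j)"] fin[OF that] e[OF that] by simp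
  ultimately show ?thesis by (simp add: sum_distrib_left)
qed

section \<open>Homomorphism densities\<close>

lemma finite_graph_homs: "finite (pverts H) \<Longrightarrow> finite (pverts G) \<Longrightarrow> finite (graph_homs H G)"
  unfolding graph_homs_def by (rule finite_subset[of _ "pverts H \<rightarrow>\<^sub>E pverts G"]) (auto intro: finite_PiE)

lemma hom_density_mono:
  assumes "finite (pverts H)" "finite (pverts G')" "pverts G = pverts G'" "parcs G \<subseteq> parcs G'"
  shows "hom_density H G \<le> hom_density H G'"
proof -
  have "graph_homs H G \<subseteq> graph_homs H G'"
    using assms(3,4) by (fastforce simp: graph_homs_def)
  then have "card (graph_homs H G) \<le> card (graph_homs H G')"
    using finite_graph_homs[OF assms(1,2)] by (rule card_mono[rotated])
  then show ?thesis using assms(3) by (simp add: hom_density_def divide_right_mono)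
qed

lemma hom_density_no_arcs:
  "parcs H = {} \<Longrightarrow> pverts G = pverts G' \<Longrightarrow> hom_density H G = hom_density H G'"
  by (simp add: hom_density_def graph_homs_def)

text \<open>A homomorphism from an edge is an arc of G, namely the ordered pair of images of the
  endpoints, and every undirected edge yields two arcs.\<close>

lemma hom_density_single_edge:
  assumes "is_single_edge H" "G \<in> simple_graphs n" "0 < n"
  shows "(real n)\<^sup>2 * hom_density H G = 2 * real (card (upper_arcs G))"
proof -
  obtain u v where uv: "u \<noteq> v" "pverts H = {u, v}" "parcs H = {(u, v), (v, u)}"
    using assms(1) by (auto simp: is_single_edge_def)
  note G = simple_graphsD[OF assms(2)]
  have "bij_betw (\<lambda>f. (f u, f v)) (graph_homs H G) (parcs G)"
  proof (rule bij_betw_byWitness[where f' = "\<lambda>(x, y). restrict (\<lambda>w. if w = u then x else y) {u, v}"])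
    show "\<forall>f\<in>graph_homs H G. (\<lambda>(x, y). restrict (\<lambda>w. if w = u then x else y) {u, v}) (f u, f v) = f"
      using uv by (auto simp: graph_homs_def PiE_def extensional_def restrict_def fun_eq_iff)
    show "(\<lambda>(x, y). restrict (\<lambda>w. if w = u then x else y) {u, v}) ` parcs G \<subseteq> graph_homs H G"
      using uv G(1,3,4) by (fastforce simp: graph_homs_def)
  qed (use uv in \<open>auto simp: graph_homs_def\<close>)
  then have "card (graph_homs H G) = 2 * card (upper_arcs G)"
    using card_parcs[OF assms(2)] by (simp add: bij_betw_same_card)
  then show ?thesis using uv G(1) assms(3) by (simp add: hom_density_def power2_eq_square)
qed

text \<open>With at least one edge but not exactly one, there are two distinct edges, and the second
  has an endpoint outside the first.\<close>

lemma three_nonisolated_vertices: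
  assumes "pair_graph H" "card (undirected_edges H) \<noteq> 1" "parcs H \<noteq> {}"
  obtains S where "S \<subseteq> pverts H" "card S = 3" "S \<subseteq> Field (parcs H)"
proof -
  interpret pair_graph H by (rule assms(1))
  obtain u v where uv: "(u, v) \<in> parcs H" using assms(3) by auto
  have "undirected_edges H \<noteq> {{u, v}}" using assms(2) by auto
  moreover have "{u, v} \<in> undirected_edges H" using uv by (auto simp: undirected_edges_def)
  ultimately obtain x y where xy: "(x, y) \<in> parcs H" "{x, y} \<noteq> {u, v}"
    by (auto simp: undirected_edges_def)
  have ne: "u \<noteq> v" "x \<noteq> y" using uv xy pair_no_loops by fastforce+
  obtain w where w: "w \<in> {x, y}" "w \<notin> {u, v}" using xy(2) ne by auto
  show ?thesis
  proof
    show "{u, v, w} \<subseteq> pverts H" using uv xy w in_arcsD1 in_arcsD2 by auto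
    show "card {u, v, w} = 3" using ne w by auto
    show "{u, v, w} \<subseteq> Field (parcs H)" using uv xy w by (auto simp: Field_def)
  qed
qed

text \<open>Without arcs in H the two densities agree. Otherwise three non-isolated vertices must
  land in {i, j}, which leaves at most 2^3 n^(v-3) homomorphisms, where v is the number of vertices
  of H.\<close>

lemma hom_density_edge_graph_le:
  assumes "pair_graph H" "card (undirected_edges H) \<noteq> 1"
    and "i \<in> {1..n}" "j \<in> {1..n}" "i \<noteq> j"
  shows "hom_density H (arc_graph n {(i, j), (j, i)}) \<le> hom_density H (arc_graph n {}) + 8 / real n ^ 3"
proof (cases "parcs H = {}")
  case True
  then show ?thesis using hom_density_no_arcs[OF True, of "arc_graph n {(i, j), (j, i)}" "arc_graph n {}"]
    by simp
next
  case False
  interpret pair_graph H by (rule assms(1))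
  let ?G = "arc_graph n {(i, j), (j, i)}"
  obtain S where S: "S \<subseteq> pverts H" "card S = 3" "S \<subseteq> Field (parcs H)"
    using three_nonisolated_vertices[OF assms(1,2) False] .
  have finS: "finite S" using S(2) by (metis card.infinite zero_neq_numeral)
  have n: "0 < n" using assms(3) by auto
  let ?B = "\<lambda>x. if x \<in> S then {i, j} else {1..n}"
  have "graph_homs H ?G \<subseteq> PiE (pverts H) ?B"
  proof
    fix f assume f: "f \<in> graph_homs H ?G"
    have "f x \<in> {i, j}" if "x \<in> S" for x
      using f S(3) that by (fastforce simp: graph_homs_def Field_def)
    then show "f \<in> PiE (pverts H) ?B" using f by (auto simp: graph_homs_def PiE_iff)
  qed
  then have "card (graph_homs H ?G) \<le> card (PiE (pverts H) ?B)"
    by (intro card_mono finite_PiE) (auto simp: pair_finite_verts)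
  also have "\<dots> = (\<Prod>x\<in>pverts H. if x \<in> S then 2 else n)"
    using assms(5) by (subst card_PiE[OF pair_finite_verts]) (auto intro!: prod.cong)
  also have "\<dots> = 2 ^ card S * n ^ card (pverts H - S)"
    using S(1) pair_finite_verts by (subst prod.If_cases) (auto simp: Int_absorb1 Diff_eq)
  finally have le: "card (graph_homs H ?G) \<le> 8 * n ^ card (pverts H - S)" using S(2) by simp
  have "card (pverts H) = card (pverts H - S) + 3"
    using S finS card_Diff_subset[OF finS S(1)] card_mono[OF pair_finite_verts S(1)] by simp
  then have "hom_density H ?G \<le> real (8 * n ^ card (pverts H - S)) / real n ^ (card (pverts H - S) + 3)"
    using le by (auto simp: hom_density_def simp del: of_nat_mult of_nat_power intro!: divide_right_mono)
  also have "\<dots> = 8 / real n ^ 3" using n by (simp add: power_add)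
  \<comment> \<open>Only nonnegativity of the added density is used; it gives both cases the same
    form.\<close>
  also have "\<dots> \<le> hom_density H (arc_graph n {}) + 8 / real n ^ 3"
    by (simp add: hom_density_def)
  finally show ?thesis .
qed

section \<open>Weights compared with the weight of the empty graph\<close>

lemma ergm_weight_split:
  assumes "1 \<le> k" "is_single_edge (H 1)" "G \<in> simple_graphs n" "0 < n"
  shows "ergm_weight n k b H G = exp (2 * b 1) ^ card (upper_arcs G)
    * exp ((real n)\<^sup>2 * (\<Sum>p = 2..k. b p * hom_density (H p) G))"
proof -
  have "(\<Sum>p = 1..k. b p * hom_density (H p) G)
      = b 1 * hom_density (H 1) G + (\<Sum>p = 2..k. b p * hom_density (H p) G)"
    using assms(1) by (simp add: sum.atLeast_Suc_atMost numeral_2_eq_2)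
  moreover have "(real n)\<^sup>2 * (b 1 * hom_density (H 1) G) = real (card (upper_arcs G)) * (2 * b 1)"
    using hom_density_single_edge[OF assms(2-4)] by (simp add: mult.left_commute mult_ac)
  ultimately show ?thesis
    by (simp add: ergm_weight_def distrib_left exp_add flip: exp_of_nat_mult)
qed

lemma upper_arcs_empty [simp]: "upper_arcs (arc_graph n {}) = {}"
  by (simp add: upper_arcs_def)

text \<open>The empty graph minimises every density, so with nonpositive coefficients it maximises
  the factor coming from p >= 2. Its own weight is kept as a factor because it need not be 1: an
  arcless \<open>H p\<close> has density 1 in every graph.\<close>

lemma ergm_weight_le:
  assumes "1 \<le> k" "is_single_edge (H 1)" "G \<in> simple_graphs n" "0 < n"
    and "\<And>p. p \<in> {2..k} \<Longrightarrow> b p \<le> 0" "\<And>p. p \<in> {2..k} \<Longrightarrow> pair_graph (H p)"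
  shows "ergm_weight n k b H G
    \<le> ergm_weight n k b H (arc_graph n {}) * exp (2 * b 1) ^ card (upper_arcs G)"
proof -
  have "(\<Sum>p = 2..k. b p * hom_density (H p) G)
      \<le> (\<Sum>p = 2..k. b p * hom_density (H p) (arc_graph n {}))"
  proof (intro sum_mono mult_left_mono_neg hom_density_mono)
    fix p assume "p \<in> {2..k}"
    then interpret pair_graph "H p" using assms(6) by blast
    show "finite (pverts (H p))" by (rule pair_finite_verts)
  qed (use assms(5) simple_graphsD(1)[OF assms(3)] in auto)
  then show ?thesis
    using assms(4) by (simp add: ergm_weight_split[where H = H, OF assms(1-4)]
        ergm_weight_split[where H = H, OF assms(1,2) empty_graph_simple assms(4)] mult_left_mono)
qed

text \<open>The density excess 8 / n^3 becomes 8 / n after multiplication by n^2. Nonpositive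
  coefficients turn this upper bound on densities into a lower bound on the weight.\<close>

lemma ergm_weight_edge_graph_ge:
  assumes "1 \<le> k" "is_single_edge (H 1)" "i \<in> {1..n}" "j \<in> {1..n}" "i < j"
    and "\<And>p. p \<in> {2..k} \<Longrightarrow> b p \<le> 0" "\<And>p. p \<in> {2..k} \<Longrightarrow> pair_graph (H p)"
    and "\<And>p. p \<in> {2..k} \<Longrightarrow> card (undirected_edges (H p)) \<noteq> 1"
  shows "ergm_weight n k b H (arc_graph n {}) * exp (2 * b 1) * exp (8 * (\<Sum>p = 2..k. b p) / real n)
    \<le> ergm_weight n k b H (arc_graph n {(i, j), (j, i)})"
proof -
  let ?G = "arc_graph n {(i, j), (j, i)}"
  have n: "0 < n" using assms(3) by auto
  have "(\<Sum>p = 2..k. b p * (hom_density (H p) (arc_graph n {}) + 8 / real n ^ 3))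
      \<le> (\<Sum>p = 2..k. b p * hom_density (H p) ?G)"
    using assms by (intro sum_mono mult_left_mono_neg hom_density_edge_graph_le) auto
  then have "(\<Sum>p = 2..k. b p * hom_density (H p) (arc_graph n {})) + (\<Sum>p = 2..k. b p) * (8 / real n ^ 3)
      \<le> (\<Sum>p = 2..k. b p * hom_density (H p) ?G)"
    by (simp only: distrib_left sum.distrib sum_distrib_right)
  then have "(real n)\<^sup>2 * ((\<Sum>p = 2..k. b p * hom_density (H p) (arc_graph n {}))
        + (\<Sum>p = 2..k. b p) * (8 / real n ^ 3))
      \<le> (real n)\<^sup>2 * (\<Sum>p = 2..k. b p * hom_density (H p) ?G)"
    by (rule mult_left_mono) simp
  moreover have "(real n)\<^sup>2 * ((\<Sum>p = 2..k. b p) * (8 / real n ^ 3)) = 8 * (\<Sum>p = 2..k. b p) / real n"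
    using n by (simp add: power2_eq_square power3_eq_cube field_simps)
  ultimately have "exp ((real n)\<^sup>2 * (\<Sum>p = 2..k. b p * hom_density (H p) (arc_graph n {})))
        * exp (8 * (\<Sum>p = 2..k. b p) / real n)
      \<le> exp ((real n)\<^sup>2 * (\<Sum>p = 2..k. b p * hom_density (H p) ?G))"
    by (simp add: distrib_left flip: exp_add)
  moreover have "upper_arcs ?G = {(i, j)}" using assms(5) by (auto simp: upper_arcs_def)
  moreover have "?G \<in> simple_graphs n" using assms(3-5) by (intro edge_graph_simple) auto
  ultimately show ?thesis
    using n by (simp add: ergm_weight_split[where H = H, OF assms(1,2)] empty_graph_simple mult_ac)
qed

section \<open>Bounds for the edge probability and the limit\<close>

lemma prob_ergm:
  "\<P>(G in ergm n k b H. P G)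
    = (\<Sum>G | G \<in> simple_graphs n \<and> P G. ergm_weight n k b H G) / ergm_partition n k b H"
proof -
  have "0 \<le> ergm_weight n k b H G / ergm_partition n k b H" for G
    using ergm_partition_pos[of n k b H] by (simp add: ergm_weight_def)
  then show ?thesis
    by (simp add: ergm_def space_point_measure measure_point_measure_finite_if finite_simple_graphs
        subset_eq sum_divide_distrib)
qed

lemma prob_edge_ergm_bounds:
  assumes "1 \<le> k" "is_single_edge (H 1)" "i \<in> {1..n}" "j \<in> {1..n}" "i < j"
    and "\<And>p. p \<in> {2..k} \<Longrightarrow> b p \<le> 0" "\<And>p. p \<in> {2..k} \<Longrightarrow> pair_graph (H p)"
    and "\<And>p. p \<in> {2..k} \<Longrightarrow> card (undirected_edges (H p)) \<noteq> 1"
  shows "\<P>(G in ergm n k b H. (i, j) \<in> parcs G) / exp (2 * b 1) \<le> exp ((real n)\<^sup>2 * exp (2 * b 1))"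
      (is "?P / ?q \<le> ?E")
    and "exp (8 * (\<Sum>p = 2..k. b p) / real n - (real n)\<^sup>2 * exp (2 * b 1))
      \<le> \<P>(G in ergm n k b H. (i, j) \<in> parcs G) / exp (2 * b 1)"
proof -
  let ?w = "ergm_weight n k b H" and ?Z = "ergm_partition n k b H"
  let ?T = "{G \<in> simple_graphs n. (i, j) \<in> parcs G}"
  let ?v = "?w (arc_graph n {})" and ?D = "exp (8 * (\<Sum>p = 2..k. b p) / real n)"
  have n: "0 < n" using assms(3) by auto
  have pos: "0 < ?w G" for G by (simp add: ergm_weight_def)
  have Zpos: "0 < ?Z" by (rule ergm_partition_pos)
  have le: "?w G \<le> ?v * ?q ^ card (upper_arcs G)" if "G \<in> simple_graphs n" for G
    using that n assms by (intro ergm_weight_le) auto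
  have fin: "finite (simple_graphs n)" by (rule finite_simple_graphs)
  \<comment> \<open>The empty graph alone bounds the partition function from below; this serves the
    upper bound on the probability.\<close>
  have Zge: "?v \<le> ?Z"
    unfolding ergm_partition_def
    by (rule member_le_sum) (use fin empty_graph_simple pos in \<open>auto intro: less_imp_le\<close>)
  have "?Z \<le> (\<Sum>G\<in>simple_graphs n. ?v * ?q ^ card (upper_arcs G))"
    unfolding ergm_partition_def by (rule sum_mono) (rule le)
  also have "\<dots> \<le> ?v * ?E"
    using sum_edges_le_exp[of ?q n] pos[of "arc_graph n {}"]
    by (simp add: flip: sum_distrib_left)
  finally have Zle: "?Z \<le> ?v * ?E" .
  have "sum ?w ?T \<le> (\<Sum>G\<in>?T. ?v * ?q ^ card (upper_arcs G))"
    by (rule sum_mono) (use le in auto)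
  also have "\<dots> \<le> ?v * (?q * ?E)"
    using sum_edges_containing_le_exp[of ?q i j n] assms(5) pos[of "arc_graph n {}"]
    by (simp add: flip: sum_distrib_left)
  also have "\<dots> \<le> ?Z * (?q * ?E)" using Zge by (intro mult_right_mono) auto
  finally show "?P / ?q \<le> ?E"
    using Zpos by (simp add: prob_ergm divide_le_eq mult_ac)
  \<comment> \<open>For the lower bound, only the graph whose single edge is {i, j} is kept in the
    numerator.\<close>
  have "?v * ?q * ?D \<le> ?w (arc_graph n {(i, j), (j, i)})"
    using assms by (intro ergm_weight_edge_graph_ge) auto
  also have "\<dots> \<le> sum ?w ?T"
    by (rule member_le_sum)
      (use fin edge_graph_simple[OF assms(3,4)] assms(5) pos in \<open>auto intro: less_imp_le\<close>)
  finally have ge: "?v * ?q * ?D \<le> sum ?w ?T" .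
  \<comment> \<open>Dividing by \<open>?E\<close> compensates for the bound
    \<open>?Z \<le> ?v * ?E\<close>, so that the weight \<open>?v\<close> of the empty graph
    cancels.\<close>
  have "?q * ?D / ?E * ?Z \<le> ?q * ?D / ?E * (?v * ?E)"
    using Zle by (intro mult_left_mono) auto
  also have "\<dots> = ?v * ?q * ?D" by simp
  also note ge
  finally have "?D / ?E \<le> sum ?w ?T / ?Z / ?q"
    using Zpos by (simp add: pos_le_divide_eq mult_ac)
  then show "exp (8 * (\<Sum>p = 2..k. b p) / real n - (real n)\<^sup>2 * ?q) \<le> ?P / ?q"
    by (simp add: prob_ergm exp_diff)
qed

text \<open>The condition on \<open>undirected_edges\<close> excludes a further \<open>H p\<close>
  with exactly one edge. Isolated vertices cancel in the density, so such a graph would have the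
  density of \<open>H 1\<close>, each edge would cost at least a further factor
  \<open>exp (2 * \<beta> p * \<alpha> n)\<close>, and the ratio would tend to 0.\<close>

theorem theorem2p1:
  fixes k :: nat and \<beta> :: "nat \<Rightarrow> real" and H :: "nat \<Rightarrow> 'a pair_pre_digraph"
    and \<alpha> :: "nat \<Rightarrow> real" and i :: nat
  assumes "1 \<le> k"
    and "\<And>p. p \<in> {1..k} \<Longrightarrow> \<beta> p < 0"
    and "\<And>p. p \<in> {1..k} \<Longrightarrow> pair_graph (H p)"
    and "is_single_edge (H 1)"
    and "\<And>p. p \<in> {2..k} \<Longrightarrow> card (undirected_edges (H p)) \<noteq> 1"
    and "filterlim \<alpha> at_top sequentially"
    and "(\<lambda>n. (real n)\<^sup>2 * exp (2 * \<alpha> n * \<beta> 1)) \<longlonglongrightarrow> 0"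
    and "(\<lambda>n. \<alpha> n / real n) \<longlonglongrightarrow> 0"
    and "1 \<le> i" and "i \<noteq> 1"
  shows "(\<lambda>n. \<P>(G in ergm n k (\<lambda>p. \<beta> p * \<alpha> n) H. edge_indicator 1 i G = 1)
              / exp (2 * \<alpha> n * \<beta> 1)) \<longlonglongrightarrow> 1"
    (is "?r \<longlonglongrightarrow> 1")
proof (rule tendsto_sandwich)
  let ?e = "\<lambda>n. (real n)\<^sup>2 * exp (2 * \<alpha> n * \<beta> 1)"
  let ?C = "8 * (\<Sum>p = 2..k. \<beta> p)"
  \<comment> \<open>The finite bounds need nonpositive coefficients
    \<open>\<beta> p * \<alpha> n\<close> and a vertex i in the graph, hence \<alpha> n >= 0 and n
    >= i; both hold eventually.\<close>
  have "eventually (\<lambda>n. 0 \<le> \<alpha> n) sequentially"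
    using assms(6) by (simp add: filterlim_at_top)
  then have "eventually (\<lambda>n. exp (?C * (\<alpha> n / real n) - ?e n) \<le> ?r n \<and> ?r n \<le> exp (?e n)) sequentially"
    using eventually_ge_at_top[of i]
  proof eventually_elim
    case (elim n)
    let ?b = "\<lambda>p. \<beta> p * \<alpha> n"
    have "?b p \<le> 0" if "p \<in> {2..k}" for p
      using that elim assms(2)[of p] by (simp add: mult_nonpos_nonneg)
    note bounds = prob_edge_ergm_bounds[of k H 1 n i ?b, OF assms(1,4) _ _ _ this]
    have C: "?C * (\<alpha> n / real n) = 8 * (\<Sum>p = 2..k. ?b p) / real n"
      by (simp add: sum_distrib_right)
    have q: "2 * \<alpha> n * \<beta> 1 = 2 * ?b 1" by simp
    have edge: "edge_indicator 1 i G = 1 \<longleftrightarrow> (1, i) \<in> parcs G" for G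
      by (simp add: edge_indicator_def)
    show ?case
      unfolding C q edge by (intro conjI bounds) (use elim assms in auto)
  qed
  then show "eventually (\<lambda>n. exp (?C * (\<alpha> n / real n) - ?e n) \<le> ?r n) sequentially"
    and "eventually (\<lambda>n. ?r n \<le> exp (?e n)) sequentially"
    by (auto elim: eventually_mono)
  show "(\<lambda>n. exp (?e n)) \<longlonglongrightarrow> 1"
    using tendsto_exp[OF assms(7)] by simp
  \<comment> \<open>The two growth conditions enter separately: \<alpha> n / n controls the
    densities for p >= 2, and n^2 q controls the partition function.\<close>
  have "(\<lambda>n. ?C * (\<alpha> n / real n) - ?e n) \<longlonglongrightarrow> ?C * 0 - 0"
    by (intro tendsto_intros assms(7,8))
  then show "(\<lambda>n. exp (?C * (\<alpha> n / real n) - ?e n)) \<longlonglongrightarrow> 1"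
    using tendsto_exp by fastforce
qed

end
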